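(* Let $S=\langle f_1,f_2,\ldots,f_n\rangle$ be a finitely generated transcendental semigroup whose set of commutators $\Phi(S)$ is pre-compact, let $\phi\in\Phi(S)$ be a commutator of two of the generators, i.e. $\phi=[f_i,f_j]$ and $\phi^{-1}=[f_j,f_i]$ for some $i,j$, and let $$S'=\langle \phi\circ f_1\circ\phi^{-1},\ \phi\circ f_2\circ\phi^{-1},\ \ldots,\ \phi\circ f_n\circ\phi^{-1}\rangle$$ be the corresponding conjugate semigroup of $S$. Then $S'$ is nearly abelian if and only if $S$ is nearly abelian.
   Context: A transcendental semigroup $S=\langle f_\alpha\rangle$ is the set of all finite compositions $f_{\alpha_1}\circ\cdots\circ f_{\alpha_m}$ ($m\ge 1$) of members of a family $\{f_\alpha\}$ of transcendental entire functions $\mathbb{C}\to\mathbb{C}$ (the generators). Fatou set: $S$ is normal on a domain $D$ if every sequence of elements of $S$ has a subsequence which either converges uniformly on all compact subsets of $D$ or diverges to $\infty$ uniformly on all compact subsets of $D$. $F(S)$ is the set of $z\in\mathbb{C}$ such that $S$ is normal in some neighbourhood of $z$. Nearly abelian: a transcendental semigroup $S$ is nearly abelian if there is a family $\Phi=\{\phi_i\}$ of conformal maps $\mathbb{C}\to\mathbb{C}$ (bijective and holomorphic) such that (1) $\phi_i(F(S))=F(S)$ for all $\phi_i\in\Phi$, and (2) for all $f,g\in S$ there is $\phi\in\Phi$ with $f\circ g=\phi\circ g\circ f$. Commutators: $\Phi(S)$ is the set of entire functions $\phi$ for which there are $f,g\in S$ with $f\circ g=\phi\circ g\circ f$; one then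 writes $\phi=[f,g]$ (it is uniquely determined by $f$ and $g$). In the statement, $\phi:\mathbb{C}\to\mathbb{C}$ is a bijection with inverse map $\phi^{-1}$. $\Phi(S)$ is pre-compact if every sequence in $\Phi(S)$ has a subsequence converging uniformly on $\mathbb{C}$ to a non-constant holomorphic function. *)

theory Defs
  imports "HOL-Complex_Analysis.Complex_Analysis"
begin

definition transcendental_entire :: "(complex \<Rightarrow> complex) \<Rightarrow> bool" where
  "transcendental_entire f \<longleftrightarrow> f holomorphic_on UNIV \<and> \<not> (\<exists>p. f = poly p)"

inductive_set composition_semigroup :: "('a \<Rightarrow> 'a) set \<Rightarrow> ('a \<Rightarrow> 'a) set"
  for G :: "('a \<Rightarrow> 'a) set" where
  generator: "f \<in> G \<Longrightarrow> f \<in> composition_semigroup G"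
| compose: "f \<in> G \<Longrightarrow> h \<in> composition_semigroup G \<Longrightarrow> f \<circ> h \<in> composition_semigroup G"

definition transcendental_semigroup :: "(complex \<Rightarrow> complex) set \<Rightarrow> bool" where
  "transcendental_semigroup S \<longleftrightarrow>
     (\<exists>G. G \<noteq> {} \<and> (\<forall>f\<in>G. transcendental_entire f) \<and> S = composition_semigroup G)"

definition normal_on :: "(complex \<Rightarrow> complex) set \<Rightarrow> complex set \<Rightarrow> bool" where
  "normal_on S D \<longleftrightarrow>
     (\<forall>s :: nat \<Rightarrow> complex \<Rightarrow> complex. range s \<subseteq> S \<longrightarrow>
       (\<exists>r :: nat \<Rightarrow> nat. strict_mono r \<and>
         ((\<exists>g. \<forall>K. compact K \<and> K \<subseteq> D \<longrightarrow> uniform_limit K (\<lambda>n. s (r n)) g sequentially) \<or>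
          (\<forall>K. compact K \<and> K \<subseteq> D \<longrightarrow>
            (\<forall>B::real. \<forall>\<^sub>F n in sequentially. \<forall>z\<in>K. B < norm (s (r n) z))))))"

definition fatou_set :: "(complex \<Rightarrow> complex) set \<Rightarrow> complex set" where
  "fatou_set S = {z. \<exists>D. open D \<and> connected D \<and> z \<in> D \<and> normal_on S D}"

definition conformal_bijection :: "(complex \<Rightarrow> complex) \<Rightarrow> bool" where
  "conformal_bijection \<phi> \<longleftrightarrow> \<phi> holomorphic_on UNIV \<and> bij \<phi>"

definition nearly_abelian :: "(complex \<Rightarrow> complex) set \<Rightarrow> bool" where
  "nearly_abelian S \<longleftrightarrow> transcendental_semigroup S \<and>
     (\<exists>\<Phi>. (\<forall>\<phi>\<in>\<Phi>. conformal_bijection \<phi>) \<and>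
          (\<forall>\<phi>\<in>\<Phi>. \<phi> ` fatou_set S = fatou_set S) \<and>
          (\<forall>f\<in>S. \<forall>g\<in>S. \<exists>\<phi>\<in>\<Phi>. f \<circ> g = \<phi> \<circ> g \<circ> f))"

(* The notation "phi = [f, g]" is a relation here.  For transcendental entire f and g it
   determines phi, because the range of g o f is not discrete. *)
definition is_commutator ::
  "(complex \<Rightarrow> complex) \<Rightarrow> (complex \<Rightarrow> complex) \<Rightarrow> (complex \<Rightarrow> complex) \<Rightarrow> bool" where
  "is_commutator \<phi> f g \<longleftrightarrow> \<phi> holomorphic_on UNIV \<and> f \<circ> g = \<phi> \<circ> g \<circ> f"

definition commutators :: "(complex \<Rightarrow> complex) set \<Rightarrow> (complex \<Rightarrow> complex) set" where
  "commutators S = {\<phi>. \<exists>f\<in>S. \<exists>g\<in>S. is_commutator \<phi> f g}"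

(* Convergence is uniform on the whole plane, not merely locally uniform, and the limit
   need not lie in A. *)
definition pre_compact :: "(complex \<Rightarrow> complex) set \<Rightarrow> bool" where
  "pre_compact A \<longleftrightarrow>
     (\<forall>s :: nat \<Rightarrow> complex \<Rightarrow> complex. range s \<subseteq> A \<longrightarrow>
       (\<exists>r g. strict_mono (r :: nat \<Rightarrow> nat) \<and> g holomorphic_on UNIV \<and>
              \<not> g constant_on UNIV \<and> uniform_limit UNIV (\<lambda>n. s (r n)) g sequentially))"

end

theory Submission
  imports Defs
begin

text \<open>
  Near abelianness is invariant under conjugation by any conformal bijection \<open>\<phi>\<close> of the plane:
  such a map is proper, so conjugation carries both kinds of convergence in the definition of
  normality over to the conjugate family, and the Fatou set of the conjugate semigroup is the
  image of the Fatou set under \<open>\<phi>\<close>. A proper entire function is a polynomial; hence conjugation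
  also preserves transcendence of the generators.
\<close>

section \<open>Conjugation of maps and of composition semigroups\<close>

definition conjugate :: "('a \<Rightarrow> 'a) \<Rightarrow> ('a \<Rightarrow> 'a) \<Rightarrow> 'a \<Rightarrow> 'a" where
  "conjugate \<phi> f = \<phi> \<circ> f \<circ> inv \<phi>"

lemma conjugate_comp:
  assumes "bij \<phi>"
  shows "conjugate \<phi> (f \<circ> g) = conjugate \<phi> f \<circ> conjugate \<phi> g"
  using assms by (simp add: conjugate_def fun_eq_iff bij_is_inj inv_f_f)

lemma conjugate_inv_conjugate:
  assumes "bij \<phi>"
  shows "conjugate (inv \<phi>) (conjugate \<phi> f) = f"
  using assms by (simp add: conjugate_def fun_eq_iff bij_is_inj inv_f_f inv_inv_eq)

lemma image_conjugate_inv: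
  assumes "bij \<phi>"
  shows "conjugate (inv \<phi>) ` conjugate \<phi> ` A = A"
  using assms by (simp add: image_image conjugate_inv_conjugate)

text \<open>Conjugation respects composition, so a word in the generators is conjugated letter by
  letter; each inclusion is an induction on the word.\<close>

lemma composition_semigroup_conjugate:
  assumes "bij \<phi>"
  shows "composition_semigroup (conjugate \<phi> ` G) = conjugate \<phi> ` composition_semigroup G"
proof (intro equalityI subsetI)
  fix h assume "h \<in> composition_semigroup (conjugate \<phi> ` G)"
  then show "h \<in> conjugate \<phi> ` composition_semigroup G"
  proof induction
    case (generator f)
    then show ?case
      by (auto intro: composition_semigroup.generator)
  next
    case (compose f h)
    then obtain f' h' where "f' \<in> G" "f = conjugate \<phi> f'"
      and "h' \<in> composition_semigroup G" "h = conjugate \<phi> h'"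
      by auto
    then show ?case
      by (metis assms composition_semigroup.compose conjugate_comp imageI)
  qed
next
  fix h assume "h \<in> conjugate \<phi> ` composition_semigroup G"
  then obtain h' where "h' \<in> composition_semigroup G" and h: "h = conjugate \<phi> h'"
    by auto
  from this(1) have "conjugate \<phi> h' \<in> composition_semigroup (conjugate \<phi> ` G)"
  proof induction
    case (generator f)
    then show ?case
      by (auto intro: composition_semigroup.generator)
  next
    case (compose f h)
    then show ?case
      by (metis assms composition_semigroup.compose conjugate_comp imageI)
  qed
  with h show "h \<in> composition_semigroup (conjugate \<phi> ` G)"
    by simp
qed

section \<open>Conformal bijections of the plane and transcendental maps\<close>

lemma conformal_bijection_inv:
  assumes "conformal_bijection \<phi>"
  shows "conformal_bijection (inv \<phi>)"
proof -
  have hol: "\<phi> holomorphic_on UNIV" and bij: "bij \<phi>"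
    using assms by (auto simp: conformal_bijection_def)
  obtain g where g: "g holomorphic_on (\<phi> ` UNIV)" "\<And>z. g (\<phi> z) = z"
    using holomorphic_has_inverse[OF hol open_UNIV bij_is_inj[OF bij]] by (metis UNIV_I)
  \<comment> \<open>Injectivity supplies only a holomorphic left inverse \<open>g\<close> on the
    range of \<phi>; since \<phi> is onto, \<open>g\<close> is the full inverse and is
    entire.\<close>
  have "inv \<phi> = g"
    using g(2) bij by (metis ext bij_is_surj surj_f_inv_f)
  then show ?thesis
    using g(1) bij_imp_bij_inv[OF bij] bij_is_surj[OF bij] by (simp add: conformal_bijection_def)
qed

lemma conformal_bijection_conjugate:
  assumes "conformal_bijection \<phi>" "conformal_bijection \<psi>"
  shows "conformal_bijection (conjugate \<phi> \<psi>)"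
  using assms conformal_bijection_inv[OF assms(1)]
  unfolding conformal_bijection_def conjugate_def
  by (meson bij_comp holomorphic_on_compose holomorphic_on_subset subset_UNIV)

lemma conformal_bijection_continuous_on:
  assumes "conformal_bijection \<phi>"
  shows "continuous_on A \<phi>"
  using assms holomorphic_on_imp_continuous_on continuous_on_subset
  unfolding conformal_bijection_def by blast

text \<open>The preimage of a compact set is its image under the continuous map
  \<open>inv \<phi>\<close>, hence compact. So \<phi> is proper, and a proper entire function is a
  polynomial.\<close>

lemma conformal_bijection_poly:
  assumes "conformal_bijection \<phi>"
  obtains p where "\<phi> = poly p"
proof -
  have hol: "\<phi> holomorphic_on UNIV" and bij: "bij \<phi>"
    using assms by (auto simp: conformal_bijection_def)
  have "compact {z. \<phi> z \<in> K}" if "compact K" for K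
  proof -
    have "{z. \<phi> z \<in> K} = inv \<phi> ` K"
      using bij_vimage_eq_inv_image[OF bij] by (simp add: vimage_def)
    then show ?thesis
      by (simp add: compact_continuous_image[OF _ that]
          conformal_bijection_continuous_on[OF conformal_bijection_inv[OF assms]])
  qed
  then obtain c n where "\<phi> = (\<lambda>z. \<Sum>i\<le>n. c i * z ^ i)"
    using proper_map_polyfun_eq[OF hol] by auto
  then have "\<phi> = poly (\<Sum>i\<le>n. monom (c i) i)"
    by (simp add: fun_eq_iff poly_sum poly_monom)
  then show thesis
    by (rule that)
qed

text \<open>Both \<phi> and \<open>inv \<phi>\<close> are polynomials. If the conjugate were one
  too, conjugating back would exhibit \<open>f\<close> as a composition of three
  polynomials.\<close>

lemma transcendental_entire_conjugate:
  assumes \<phi>: "conformal_bijection \<phi>" and f: "transcendental_entire f"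
  shows "transcendental_entire (conjugate \<phi> f)"
  unfolding transcendental_entire_def
proof
  show "conjugate \<phi> f holomorphic_on UNIV"
    using f \<phi> conformal_bijection_inv[OF \<phi>]
    unfolding conjugate_def transcendental_entire_def conformal_bijection_def
    by (meson holomorphic_on_compose holomorphic_on_subset subset_UNIV)
  show "\<nexists>p. conjugate \<phi> f = poly p"
  proof
    assume "\<exists>p. conjugate \<phi> f = poly p"
    then obtain p where p: "conjugate \<phi> f = poly p" ..
    obtain q where q: "\<phi> = poly q"
      using conformal_bijection_poly[OF \<phi>] .
    obtain r where r: "inv \<phi> = poly r"
      using conformal_bijection_poly[OF conformal_bijection_inv[OF \<phi>]] .
    have bij: "bij \<phi>"
      using \<phi> by (simp add: conformal_bijection_def)
    have "f = inv \<phi> \<circ> poly p \<circ> \<phi>"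
      using conjugate_inv_conjugate[OF bij, of f] p bij by (simp add: conjugate_def inv_inv_eq)
    also have "\<dots> = poly (r \<circ>\<^sub>p p \<circ>\<^sub>p q)"
      unfolding r by (simp add: q fun_eq_iff poly_pcompose)
    finally show False
      using f by (auto simp: transcendental_entire_def)
  qed
qed

lemma transcendental_semigroup_conjugate:
  assumes "conformal_bijection \<phi>" "transcendental_semigroup S"
  shows "transcendental_semigroup (conjugate \<phi> ` S)"
proof -
  obtain G where "G \<noteq> {}" "\<forall>f\<in>G. transcendental_entire f" "S = composition_semigroup G"
    using assms(2) by (auto simp: transcendental_semigroup_def)
  then show ?thesis
    using assms(1) composition_semigroup_conjugate[of \<phi> G] transcendental_entire_conjugate
    unfolding transcendental_semigroup_def conformal_bijection_def
    by (intro exI[of _ "conjugate \<phi> ` G"]) auto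
qed

text \<open>Provides the continuity of semigroup elements that \<open>normal_on_conjugate\<close>
  asks for.\<close>

lemma transcendental_semigroup_holomorphic:
  assumes "transcendental_semigroup S" "f \<in> S"
  shows "f holomorphic_on UNIV"
proof -
  obtain G where G: "\<forall>f\<in>G. transcendental_entire f" "f \<in> composition_semigroup G"
    using assms by (auto simp: transcendental_semigroup_def)
  from G(2) show ?thesis
  proof induction
    case (generator f)
    then show ?case
      using G(1) by (simp add: transcendental_entire_def)
  next
    case (compose f h)
    then have "f holomorphic_on UNIV"
      using G(1) by (simp add: transcendental_entire_def)
    then show ?case
      using compose.IH by (meson holomorphic_on_compose holomorphic_on_subset subset_UNIV)
  qed
qed

section \<open>Normality, Fatou sets and near abelianness under conjugation\<close>

lemma uniform_limit_compose_continuous: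
  fixes \<phi> :: "'b::euclidean_space \<Rightarrow> 'c::metric_space"
  assumes lim: "uniform_limit K f g F" and g: "bounded (g ` K)" and \<phi>: "continuous_on UNIV \<phi>"
  shows "uniform_limit K (\<lambda>n x. \<phi> (f n x)) (\<lambda>x. \<phi> (g x)) F"
proof -
  obtain B where B: "\<And>x. x \<in> K \<Longrightarrow> norm (g x) \<le> B"
    using g by (auto simp: bounded_iff)
  show ?thesis
  proof (rule uniform_limit_compose_uniformly_continuous_on[OF lim])
    \<comment> \<open>Continuity of \<phi> is uniform only on compact sets. Radius
      \<open>B + 1\<close> suffices: the limit stays within \<open>B\<close>, and eventually every
      \<open>f n x\<close> is within distance 1 of it.\<close>
    show "uniformly_continuous_on (cball 0 (B + 1)) \<phi>"
      by (intro compact_uniformly_continuous continuous_on_subset[OF \<phi>]) auto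
    show "\<forall>\<^sub>F n in F. \<forall>x\<in>K. f n x \<in> cball 0 (B + 1)"
      using uniform_limitD[OF lim zero_less_one]
    proof eventually_elim
      case (elim n)
      show ?case
      proof
        fix x assume "x \<in> K"
        then have "norm (f n x - g x) < 1" "norm (g x) \<le> B"
          using elim B by (auto simp: dist_norm)
        then show "f n x \<in> cball 0 (B + 1)"
          using norm_triangle_sub[of "f n x" "g x"] by simp
      qed
    qed
  qed simp
qed

text \<open>The points that \<phi> sends into the closed ball of radius \<open>B\<close> form a
  compact set, and any bound for that set serves as \<open>C\<close>. This carries divergence to
  infinity through \<phi>.\<close>

lemma conformal_bijection_coercive:
  assumes "conformal_bijection \<phi>"
  obtains C where "\<And>z. C < norm z \<Longrightarrow> B < norm (\<phi> z)"
proof -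
  have bij: "bij \<phi>"
    using assms by (simp add: conformal_bijection_def)
  have "compact (inv \<phi> ` cball 0 B)"
    by (intro compact_continuous_image compact_cball
        conformal_bijection_continuous_on conformal_bijection_inv assms)
  then obtain C where C: "\<And>w. w \<in> inv \<phi> ` cball 0 B \<Longrightarrow> norm w \<le> C"
    by (meson bounded_iff compact_imp_bounded)
  show thesis
  proof (rule that, rule ccontr)
    fix z assume "C < norm z" "\<not> B < norm (\<phi> z)"
    moreover have "z = inv \<phi> (\<phi> z)"
      using bij by (simp add: bij_is_inj)
    ultimately show False
      using C[of z] by force
  qed
qed

text \<open>Pulling back by \<open>inv \<phi>\<close> turns compact subsets of the image of
  \<open>D\<close> into compact subsets of \<open>D\<close>, so the subsequence found for the
  original family also works for the conjugates, with the same alternative of convergence or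
  divergence.\<close>

lemma normal_on_conjugate:
  assumes \<phi>: "conformal_bijection \<phi>" and cont: "\<And>f. f \<in> S \<Longrightarrow> continuous_on D f"
    and normal: "normal_on S D"
  shows "normal_on (conjugate \<phi> ` S) (\<phi> ` D)"
  unfolding normal_on_def
proof (intro allI impI)
  fix s :: "nat \<Rightarrow> complex \<Rightarrow> complex"
  assume "range s \<subseteq> conjugate \<phi> ` S"
  then have "\<forall>n. \<exists>f\<in>S. s n = conjugate \<phi> f"
    by blast
  then obtain t where t: "\<And>n. t n \<in> S" "\<And>n. s n = conjugate \<phi> (t n)"
    by metis
  have bij: "bij \<phi>"
    using \<phi> by (simp add: conformal_bijection_def)
  have inv_image: "compact (inv \<phi> ` K)" "inv \<phi> ` K \<subseteq> D" if "compact K" "K \<subseteq> \<phi> ` D" for K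
  proof -
    show "compact (inv \<phi> ` K)"
      by (intro compact_continuous_image that
          conformal_bijection_continuous_on conformal_bijection_inv \<phi>)
    show "inv \<phi> ` K \<subseteq> D"
      using that(2) bij by (auto simp: bij_is_inj)
  qed
  have "range t \<subseteq> S"
    using t(1) by blast
  then obtain r :: "nat \<Rightarrow> nat" where r: "strict_mono r" and
    alt: "(\<exists>g. \<forall>K. compact K \<and> K \<subseteq> D \<longrightarrow> uniform_limit K (\<lambda>n. t (r n)) g sequentially) \<or>
          (\<forall>K. compact K \<and> K \<subseteq> D \<longrightarrow>
            (\<forall>B::real. \<forall>\<^sub>F n in sequentially. \<forall>z\<in>K. B < norm (t (r n) z)))"
    using normal unfolding normal_on_def by blast
  from alt have "(\<exists>g. \<forall>K. compact K \<and> K \<subseteq> \<phi> ` D \<longrightarrow> uniform_limit K (\<lambda>n. s (r n)) g sequentially) \<or>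
          (\<forall>K. compact K \<and> K \<subseteq> \<phi> ` D \<longrightarrow>
            (\<forall>B::real. \<forall>\<^sub>F n in sequentially. \<forall>z\<in>K. B < norm (s (r n) z)))"
  proof (rule disj_forward)
    assume "\<exists>g. \<forall>K. compact K \<and> K \<subseteq> D \<longrightarrow> uniform_limit K (\<lambda>n. t (r n)) g sequentially"
    then obtain g where
      g: "\<And>K. compact K \<Longrightarrow> K \<subseteq> D \<Longrightarrow> uniform_limit K (\<lambda>n. t (r n)) g sequentially"
      by blast
    have "uniform_limit K (\<lambda>n. s (r n)) (conjugate \<phi> g) sequentially"
      if K: "compact K" "K \<subseteq> \<phi> ` D" for K
    proof -
      note L = inv_image[OF K]
      \<comment> \<open>This is where \<open>cont\<close> enters: a uniform limit of continuous maps
        is continuous, hence bounded on the compact set, as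
        \<open>uniform_limit_compose_continuous\<close> requires.\<close>
      have "continuous_on (inv \<phi> ` K) g"
        using g[OF L] t(1) cont L(2)
        by (intro uniform_limit_theorem[where F = sequentially] always_eventually)
          (auto intro: continuous_on_subset)
      then have "bounded (g ` inv \<phi> ` K)"
        using L(1) compact_continuous_image compact_imp_bounded by blast
      from uniform_limit_compose_continuous[OF g[OF L] this conformal_bijection_continuous_on[OF \<phi>]]
      have "uniform_limit K (\<lambda>n x. \<phi> (t (r n) (inv \<phi> x))) (\<lambda>x. \<phi> (g (inv \<phi> x))) sequentially"
        \<comment> \<open>Substituting \<open>inv \<phi> x\<close> for the variable moves the
          convergence from the pulled-back compact set to \<open>K\<close>.\<close>
        by (rule uniform_limit_compose') auto
      then show ?thesis
        by (simp add: t(2) conjugate_def o_def)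
    qed
    then show "\<exists>g. \<forall>K. compact K \<and> K \<subseteq> \<phi> ` D \<longrightarrow> uniform_limit K (\<lambda>n. s (r n)) g sequentially"
      by blast
  next
    assume div: "\<forall>K. compact K \<and> K \<subseteq> D \<longrightarrow>
            (\<forall>B::real. \<forall>\<^sub>F n in sequentially. \<forall>z\<in>K. B < norm (t (r n) z))"
    show "\<forall>K. compact K \<and> K \<subseteq> \<phi> ` D \<longrightarrow>
            (\<forall>B::real. \<forall>\<^sub>F n in sequentially. \<forall>z\<in>K. B < norm (s (r n) z))"
    proof (intro allI impI)
      fix K and B :: real assume "compact K \<and> K \<subseteq> \<phi> ` D"
      then have L: "compact (inv \<phi> ` K)" "inv \<phi> ` K \<subseteq> D"
        using inv_image by auto
      obtain C where C: "\<And>z. C < norm z \<Longrightarrow> B < norm (\<phi> z)"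
        using conformal_bijection_coercive[OF \<phi>] by blast
      have "\<forall>\<^sub>F n in sequentially. \<forall>z\<in>inv \<phi> ` K. C < norm (t (r n) z)"
        using div L by blast
      then show "\<forall>\<^sub>F n in sequentially. \<forall>z\<in>K. B < norm (s (r n) z)"
        by eventually_elim (simp add: t(2) conjugate_def C)
    qed
  qed
  with r show "\<exists>r. strict_mono r \<and>
         ((\<exists>g. \<forall>K. compact K \<and> K \<subseteq> \<phi> ` D \<longrightarrow> uniform_limit K (\<lambda>n. s (r n)) g sequentially) \<or>
          (\<forall>K. compact K \<and> K \<subseteq> \<phi> ` D \<longrightarrow>
            (\<forall>B::real. \<forall>\<^sub>F n in sequentially. \<forall>z\<in>K. B < norm (s (r n) z))))"
    by blast
qed

text \<open>An injective holomorphic map is open, so \<phi> carries a connected open neighbourhood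
  on which \<open>S\<close> is normal to one of the same kind for the conjugate family.\<close>

lemma fatou_set_conjugate_supset:
  assumes \<phi>: "conformal_bijection \<phi>" and S: "transcendental_semigroup S"
  shows "\<phi> ` fatou_set S \<subseteq> fatou_set (conjugate \<phi> ` S)"
proof
  fix w assume "w \<in> \<phi> ` fatou_set S"
  then obtain z D where w: "w = \<phi> z"
    and D: "open D" "connected D" "z \<in> D" "normal_on S D"
    by (auto simp: fatou_set_def)
  have "continuous_on D f" if "f \<in> S" for f
    using transcendental_semigroup_holomorphic[OF S that]
    by (meson continuous_on_subset holomorphic_on_imp_continuous_on subset_UNIV)
  then have "normal_on (conjugate \<phi> ` S) (\<phi> ` D)"
    using normal_on_conjugate[OF \<phi>] D(4) by blast
  moreover have "open (\<phi> ` D)"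
    using \<phi> D(1) open_mapping_thm3[of \<phi> D] unfolding conformal_bijection_def
    by (meson bij_is_inj holomorphic_on_subset inj_on_subset subset_UNIV)
  moreover have "connected (\<phi> ` D)"
    using D(2) conformal_bijection_continuous_on[OF \<phi>] connected_continuous_image by blast
  ultimately show "w \<in> fatou_set (conjugate \<phi> ` S)"
    using w D(3) unfolding fatou_set_def by blast
qed

lemma fatou_set_conjugate:
  assumes \<phi>: "conformal_bijection \<phi>" and S: "transcendental_semigroup S"
  shows "fatou_set (conjugate \<phi> ` S) = \<phi> ` fatou_set S"
proof
  have bij: "bij \<phi>"
    using \<phi> by (simp add: conformal_bijection_def)
  \<comment> \<open>The reverse inclusion is the previous lemma for \<open>inv \<phi>\<close> and
    the conjugate semigroup, since conjugating back restores \<open>S\<close>.\<close>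
  have "inv \<phi> ` fatou_set (conjugate \<phi> ` S) \<subseteq> fatou_set S"
    using fatou_set_conjugate_supset[OF conformal_bijection_inv[OF \<phi>]
        transcendental_semigroup_conjugate[OF \<phi> S]]
    by (simp add: image_conjugate_inv[OF bij])
  then have "\<phi> ` inv \<phi> ` fatou_set (conjugate \<phi> ` S) \<subseteq> \<phi> ` fatou_set S"
    by (rule image_mono)
  then show "fatou_set (conjugate \<phi> ` S) \<subseteq> \<phi> ` fatou_set S"
    by (simp add: image_f_inv_f bij_is_surj[OF bij])
qed (rule fatou_set_conjugate_supset[OF assms])

text \<open>The conjugates of the maps in \<Phi> witness near abelianness: they preserve the image
  of the Fatou set under \<phi>, and the commutation identities survive because conjugation respects
  composition.\<close>

lemma nearly_abelian_conjugate:
  assumes \<phi>: "conformal_bijection \<phi>" and "nearly_abelian S"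
  shows "nearly_abelian (conjugate \<phi> ` S)"
proof -
  obtain \<Phi> where S: "transcendental_semigroup S"
    and \<Phi>: "\<And>\<psi>. \<psi> \<in> \<Phi> \<Longrightarrow> conformal_bijection \<psi>" "\<And>\<psi>. \<psi> \<in> \<Phi> \<Longrightarrow> \<psi> ` fatou_set S = fatou_set S"
    and comm: "\<And>f g. f \<in> S \<Longrightarrow> g \<in> S \<Longrightarrow> \<exists>\<psi>\<in>\<Phi>. f \<circ> g = \<psi> \<circ> g \<circ> f"
    using assms(2) unfolding nearly_abelian_def by metis
  have bij: "bij \<phi>"
    using \<phi> by (simp add: conformal_bijection_def)
  have "conjugate \<phi> \<psi> ` \<phi> ` fatou_set S = \<phi> ` fatou_set S" if "\<psi> \<in> \<Phi>" for \<psi>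
  proof -
    have "conjugate \<phi> \<psi> ` \<phi> ` fatou_set S = \<phi> ` \<psi> ` fatou_set S"
      using bij by (simp add: conjugate_def image_image bij_is_inj)
    then show ?thesis
      by (simp add: \<Phi>(2)[OF that])
  qed
  moreover have "\<exists>\<psi>\<in>\<Phi>. conjugate \<phi> f \<circ> conjugate \<phi> g =
      conjugate \<phi> \<psi> \<circ> conjugate \<phi> g \<circ> conjugate \<phi> f" if "f \<in> S" "g \<in> S" for f g
    using comm[OF that] by (metis conjugate_comp[OF bij])
  ultimately show ?thesis
    unfolding nearly_abelian_def fatou_set_conjugate[OF \<phi> S]
    using transcendental_semigroup_conjugate[OF \<phi> S] conformal_bijection_conjugate[OF \<phi> \<Phi>(1)]
    by (intro conjI exI[of _ "conjugate \<phi> ` \<Phi>"]) auto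
qed

theorem theorem2p1:
  fixes n :: nat
    and f :: "nat \<Rightarrow> complex \<Rightarrow> complex"
    and \<phi> :: "complex \<Rightarrow> complex"
    and i j :: nat
    and S S' :: "(complex \<Rightarrow> complex) set"
  assumes "\<And>k. k \<in> {1..n} \<Longrightarrow> transcendental_entire (f k)"
    and "S = composition_semigroup (f ` {1..n})"
    and "pre_compact (commutators S)"
    and "\<phi> \<in> commutators S"
    and "bij \<phi>"
    and "i \<in> {1..n}" and "j \<in> {1..n}"
    and "is_commutator \<phi> (f i) (f j)"
    and "is_commutator (inv \<phi>) (f j) (f i)"
    and "S' = composition_semigroup ((\<lambda>k. \<phi> \<circ> f k \<circ> inv \<phi>) ` {1..n})"
  shows "nearly_abelian S' \<longleftrightarrow> nearly_abelian S"
proof -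
  \<comment> \<open>Holomorphy of \<phi> is contained in \<open>is_commutator\<close>.\<close>
  have \<phi>: "conformal_bijection \<phi>"
    using assms(5,8) by (simp add: conformal_bijection_def is_commutator_def)
  have S': "S' = conjugate \<phi> ` S"
    using composition_semigroup_conjugate[OF assms(5), of "f ` {1..n}"]
    by (simp add: assms(2,10) conjugate_def image_image)
  \<comment> \<open>As \<open>S\<close> is in turn a conjugate of \<open>S'\<close>, the one
    implication \<open>nearly_abelian_conjugate\<close> yields both directions.\<close>
  then have "conjugate (inv \<phi>) ` S' = S"
    by (simp add: image_conjugate_inv assms(5))
  then show ?thesis
    using nearly_abelian_conjugate[OF \<phi>, of S] S'
      nearly_abelian_conjugate[OF conformal_bijection_inv[OF \<phi>], of S'] by auto
qed

end
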